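(* Let $N>2$ be a natural number and let $p$ be a rational prime. Let $f\in \mathcal{F}_{N}\setminus \mathcal{F}_{N}^{p}$ be a modular unit of level $N$, and let $f^{1/p}$ be a $p$-th root of $f$, i.e. a holomorphic function on $\mathcal{H}$ whose $p$-th power is $f$. If $f^{1/p}$ has level $M$ for some $M\in\mathbb{N}$ with $N\mid M$, then $f^{1/p}$ has level $pN$.
   Context: Let $\mathcal{H}$ be the complex upper half plane and $\Gamma=PSL_2(\mathbb{Z})=SL_2(\mathbb{Z})/\{\pm I\}$, acting on $\mathcal{H}$ by fractional linear transformations $A\circ z=\frac{az+b}{cz+d}$. For a natural number $N$, $\Gamma(N)\le\Gamma$ denotes the (inhomogeneous) principal congruence subgroup, i.e. the kernel of the reduction map $\Gamma\to PSL_2(\mathbb{Z}/N\mathbb{Z})$, with $\Gamma(1)=\Gamma$. A function $f$ on $\mathcal{H}$ is a modular function for $\Gamma(N)$ if it is meromorphic on $\mathcal{H}$, satisfies $f(A\circ z)=f(z)$ for all $A\in\Gamma(N)$ and all $z$, and is meromorphic at every cusp: for each $B\in\Gamma$, $f(B\circ z)$ has, for $\operatorname{Im} z$ large, a Laurent expansion with finitely many negative terms in the local variable $e^{2\pi i z/N}$. "$f$ has level $N$" means that $f$ is a modular function for $\Gamma(N)$; it is not required that $N$ be minimal. $\mathcal{F}_N$ denotes the field of modular functions of level $N$ whose Fourier coefficients (at $i\infty$) lie in $\mathbb{Q}(\zeta_N)$, where $\zeta_N$ is a primitive $N$-th root of unity; it is a finite extension of $\mathcal{F}_1=\mathbb{Q}(j(z))$,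 where $j$ is the classical $j$-function. $\mathcal{F}_N^p=\{g^p : g\in\mathcal{F}_N\}$ is the set of $p$-th powers. Let $R_N$ be the integral closure of $\mathbb{Z}[j]$ in $\mathcal{F}_N$. The modular units of level $N$ are the units of the ring $R_N$. (In particular a modular unit is holomorphic and nowhere zero on $\mathcal{H}$.) *)

theory Defs
  imports
    "HOL-Complex_Analysis.Complex_Analysis"
    "HOL-Computational_Algebra.Computational_Algebra"
    "HOL-Number_Theory.Cong"
begin

section \<open>The field of meromorphic functions on the upper half plane\<close>

definition uhp :: "complex set" where
  "uhp = {z. Im z > 0}"

lemma open_uhp: "open uhp"
  unfolding uhp_def by (rule open_halfspace_Im_gt)

lemma connected_uhp: "connected uhp"
  unfolding uhp_def by (intro convex_connected convex_halfspace_Im_gt)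

text \<open>
  A meromorphic function is represented by the unique total function that has no removable
  singularities in the upper half plane and takes the value 0 at its poles and outside the
  upper half plane. The arithmetic operations are pointwise operations followed by the removal
  of removable singularities.
\<close>

typedef mero_uhp = "{f. f nicely_meromorphic_on uhp \<and> (\<forall>z. z \<notin> uhp \<longrightarrow> f z = 0)}"
  morphisms eval_mero Abs_mero_uhp
  by (rule exI[of _ "\<lambda>_. 0"]) auto

text \<open>The value of the following function on non-meromorphic arguments is a dummy.\<close>

definition mero_of :: "(complex \<Rightarrow> complex) \<Rightarrow> mero_uhp" where
  "mero_of f =
     Abs_mero_uhp (\<lambda>z. if f meromorphic_on uhp \<and> z \<in> uhp then remove_sings f z else 0)"

lemma eval_mero_meromorphic [meromorphic_intros]: "eval_mero f meromorphic_on uhp"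
  using eval_mero[of f] by (auto simp: nicely_meromorphic_on_def)

lemma nicely_meromorphic_cong_uhp:
  assumes "f nicely_meromorphic_on uhp" "\<And>z. z \<in> uhp \<Longrightarrow> f z = g z"
  shows   "g nicely_meromorphic_on uhp"
proof -
  have ev: "eventually (\<lambda>w. f w = g w) (at z)" if "z \<in> uhp" for z
  proof -
    have "eventually (\<lambda>w. w \<in> uhp) (at z)"
      using that open_uhp by (intro eventually_at_in_open') auto
    thus ?thesis by eventually_elim (use assms(2) in auto)
  qed
  show ?thesis
    unfolding nicely_meromorphic_on_def
  proof (intro conjI ballI)
    have "f meromorphic_on uhp"
      using assms(1) by (simp add: nicely_meromorphic_on_def)
    thus "g meromorphic_on uhp"
      unfolding meromorphic_on_def
      using ev has_laurent_expansion_cong' by blast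
  next
    fix z assume z: "z \<in> uhp"
    have "is_pole f z \<longleftrightarrow> is_pole g z"
      by (rule is_pole_cong[OF ev[OF z] refl])
    moreover have "f \<midarrow>z\<rightarrow> f z \<longleftrightarrow> g \<midarrow>z\<rightarrow> f z"
      by (rule filterlim_cong[OF refl refl ev[OF z]])
    ultimately show "is_pole g z \<and> g z = 0 \<or> g \<midarrow>z\<rightarrow> g z"
      using assms z by (auto simp: nicely_meromorphic_on_def)
  qed
qed

lemma eval_mero_of:
  assumes "f meromorphic_on uhp"
  shows   "eval_mero (mero_of f) = (\<lambda>z. if z \<in> uhp then remove_sings f z else 0)"
proof -
  have "remove_sings f nicely_meromorphic_on uhp"
    by (rule remove_sings_nicely_meromorphic[OF assms])
  hence "(\<lambda>z. if z \<in> uhp then remove_sings f z else 0) nicely_meromorphic_on uhp"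
    by (rule nicely_meromorphic_cong_uhp) auto
  thus ?thesis
    using assms unfolding mero_of_def by (simp add: Abs_mero_uhp_inverse)
qed

lemma eval_mero_of_cosparse:
  assumes "f meromorphic_on uhp"
  shows   "\<forall>\<^sub>\<approx>z\<in>uhp. eval_mero (mero_of f) z = f z"
  using eventually_remove_sings_eq[OF assms] eventually_in_cosparse[OF order.refl open_uhp]
  by eventually_elim (simp add: eval_mero_of assms)

lemma remove_sings_eval_mero: "z \<in> uhp \<Longrightarrow> remove_sings (eval_mero f) z = eval_mero f z"
  using eval_mero[of f] by (auto simp: nicely_meromorphic_on_def)

lemma eval_mero_outside: "z \<notin> uhp \<Longrightarrow> eval_mero f z = 0"
  using eval_mero[of f] by auto

lemma mero_uhp_eqI:
  assumes "\<forall>\<^sub>\<approx>z\<in>uhp. eval_mero f z = eval_mero g z"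
  shows   "f = g"
proof -
  have "eval_mero f z = eval_mero g z" for z
  proof (cases "z \<in> uhp")
    case True
    hence "eventually (\<lambda>z. eval_mero f z = eval_mero g z) (at z)"
      using assms by (simp add: eventually_cosparse_open_eq open_uhp)
    hence "remove_sings (eval_mero f) z = remove_sings (eval_mero g) z"
      by (rule remove_sings_cong) auto
    thus ?thesis
      using True by (simp add: remove_sings_eval_mero)
  qed (simp add: eval_mero_outside)
  thus ?thesis
    by (metis eval_mero_inject ext)
qed

instantiation mero_uhp :: field
begin

definition zero_mero_uhp :: mero_uhp where
  "0 = mero_of (\<lambda>_. 0)"
definition one_mero_uhp :: mero_uhp where
  "1 = mero_of (\<lambda>_. 1)"
definition plus_mero_uhp :: "mero_uhp \<Rightarrow> mero_uhp \<Rightarrow> mero_uhp" where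
  "f + g = mero_of (\<lambda>z. eval_mero f z + eval_mero g z)"
definition minus_mero_uhp :: "mero_uhp \<Rightarrow> mero_uhp \<Rightarrow> mero_uhp" where
  "f - g = mero_of (\<lambda>z. eval_mero f z - eval_mero g z)"
definition uminus_mero_uhp :: "mero_uhp \<Rightarrow> mero_uhp" where
  "- f = mero_of (\<lambda>z. - eval_mero f z)"
definition times_mero_uhp :: "mero_uhp \<Rightarrow> mero_uhp \<Rightarrow> mero_uhp" where
  "f * g = mero_of (\<lambda>z. eval_mero f z * eval_mero g z)"
definition inverse_mero_uhp :: "mero_uhp \<Rightarrow> mero_uhp" where
  "inverse f = mero_of (\<lambda>z. inverse (eval_mero f z))"
definition divide_mero_uhp :: "mero_uhp \<Rightarrow> mero_uhp \<Rightarrow> mero_uhp" where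
  "f div g = mero_of (\<lambda>z. eval_mero f z / eval_mero g z)"

lemma eval_mero_arith_cosparse:
  "\<forall>\<^sub>\<approx>z\<in>uhp. eval_mero 0 z = 0"
  "\<forall>\<^sub>\<approx>z\<in>uhp. eval_mero 1 z = 1"
  "\<forall>\<^sub>\<approx>z\<in>uhp. eval_mero (f + g) z = eval_mero f z + eval_mero g z"
  "\<forall>\<^sub>\<approx>z\<in>uhp. eval_mero (f - g) z = eval_mero f z - eval_mero g z"
  "\<forall>\<^sub>\<approx>z\<in>uhp. eval_mero (- f) z = - eval_mero f z"
  "\<forall>\<^sub>\<approx>z\<in>uhp. eval_mero (f * g) z = eval_mero f z * eval_mero g z"
  "\<forall>\<^sub>\<approx>z\<in>uhp. eval_mero (inverse f) z = inverse (eval_mero f z)"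
  "\<forall>\<^sub>\<approx>z\<in>uhp. eval_mero (f div g) z = eval_mero f z / eval_mero g z"
  unfolding zero_mero_uhp_def one_mero_uhp_def plus_mero_uhp_def minus_mero_uhp_def
    uminus_mero_uhp_def times_mero_uhp_def inverse_mero_uhp_def divide_mero_uhp_def
  by (intro eval_mero_of_cosparse meromorphic_intros)+

instance proof
  fix f g h :: mero_uhp
  note A = eval_mero_arith_cosparse
  show "f * g * h = f * (g * h)"
    by (rule mero_uhp_eqI)
       (use A(6)[of "f * g" h] A(6)[of f g] A(6)[of f "g * h"] A(6)[of g h] in
          \<open>eventually_elim, simp\<close>)
  show "f * g = g * f"
    by (rule mero_uhp_eqI) (use A(6)[of f g] A(6)[of g f] in \<open>eventually_elim, simp\<close>)
  show "1 * f = f"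
    by (rule mero_uhp_eqI) (use A(6)[of 1 f] A(2) in \<open>eventually_elim, simp\<close>)
  show "f + g + h = f + (g + h)"
    by (rule mero_uhp_eqI)
       (use A(3)[of "f + g" h] A(3)[of f g] A(3)[of f "g + h"] A(3)[of g h] in
          \<open>eventually_elim, simp\<close>)
  show "f + g = g + f"
    by (rule mero_uhp_eqI) (use A(3)[of f g] A(3)[of g f] in \<open>eventually_elim, simp\<close>)
  show "0 + f = f"
    by (rule mero_uhp_eqI) (use A(3)[of 0 f] A(1) in \<open>eventually_elim, simp\<close>)
  show "- f + f = 0"
    by (rule mero_uhp_eqI) (use A(3)[of "-f" f] A(5)[of f] A(1) in \<open>eventually_elim, simp\<close>)
  show "f - g = f + - g"
    by (rule mero_uhp_eqI)
       (use A(4)[of f g] A(3)[of f "-g"] A(5)[of g] in \<open>eventually_elim, simp\<close>)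
  show "(f + g) * h = f * h + g * h"
    by (rule mero_uhp_eqI)
       (use A(6)[of "f + g" h] A(3)[of f g] A(3)[of "f * h" "g * h"] A(6)[of f h] A(6)[of g h] in
          \<open>eventually_elim, simp add: algebra_simps\<close>)
  show "f div g = f * inverse g"
    by (rule mero_uhp_eqI)
       (use A(8)[of f g] A(6)[of f "inverse g"] A(7)[of g] in
          \<open>eventually_elim, simp add: field_simps\<close>)
  show "inverse 0 = (0 :: mero_uhp)"
    by (rule mero_uhp_eqI) (use A(7)[of 0] A(1) in \<open>eventually_elim, simp\<close>)
  show "0 \<noteq> (1 :: mero_uhp)"
  proof
    assume "0 = (1 :: mero_uhp)"
    hence "\<forall>\<^sub>\<approx>z\<in>uhp. eval_mero 1 z = 0"
      using A(1) by simp
    with A(2) have "eventually (\<lambda>_. False) (cosparse uhp)"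
      by eventually_elim simp
    moreover have "\<i> \<in> uhp"
      by (simp add: uhp_def)
    ultimately show False
      by (auto simp: eventually_False)
  qed
  show "inverse f * f = 1" if "f \<noteq> 0"
  proof -
    have "\<not>(\<forall>\<^sub>\<approx>z\<in>uhp. eval_mero f z = 0)"
    proof
      assume "\<forall>\<^sub>\<approx>z\<in>uhp. eval_mero f z = 0"
      hence "\<forall>\<^sub>\<approx>z\<in>uhp. eval_mero f z = eval_mero 0 z"
        using A(1) by eventually_elim simp
      with mero_uhp_eqI that show False by blast
    qed
    hence nz: "\<forall>\<^sub>\<approx>z\<in>uhp. eval_mero f z \<noteq> 0"
      using meromorphic_imp_constant_or_avoid[OF eval_mero_meromorphic open_uhp connected_uhp]
      by blast
    show ?thesis
      by (rule mero_uhp_eqI)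
         (use nz A(6)[of "inverse f" f] A(7)[of f] A(2) in \<open>eventually_elim, simp\<close>)
  qed
qed

end

section \<open>Modular functions of level N\<close>

definition SL2Z :: "(int ^ 2 ^ 2) set" where
  "SL2Z = {A. det A = 1}"

definition moebius :: "int ^ 2 ^ 2 \<Rightarrow> complex \<Rightarrow> complex" where
  "moebius A z = (of_int (A $ 1 $ 1) * z + of_int (A $ 1 $ 2)) /
                 (of_int (A $ 2 $ 1) * z + of_int (A $ 2 $ 2))"

text \<open>
  Elements of the modular group are represented by their lifts to integer matrices. A lift
  represents an element of the kernel of the reduction map from $PSL_2(Z)$ to
  $PSL_2(Z/NZ) = SL_2(Z/NZ)/\{\pm I\}$ iff it is congruent to $I$ or $-I$ modulo $N$.
\<close>

definition principal_congruence :: "nat \<Rightarrow> (int ^ 2 ^ 2) set" where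
  "principal_congruence N = {A \<in> SL2Z.
     (\<forall>i j. [A $ i $ j = mat 1 $ i $ j] (mod int N)) \<or>
     (\<forall>i j. [A $ i $ j = - (mat 1 $ i $ j)] (mod int N))}"

definition has_q_expansion :: "nat \<Rightarrow> (complex \<Rightarrow> complex) \<Rightarrow> complex fls \<Rightarrow> bool" where
  "has_q_expansion N f F \<longleftrightarrow> fls_conv_radius F > 0 \<and>
     (\<exists>c>0. \<forall>z. Im z > c \<longrightarrow> f z = eval_fls F (exp (2 * pi * \<i> * z / of_nat N)))"

definition has_level :: "nat \<Rightarrow> mero_uhp \<Rightarrow> bool" where
  "has_level N f \<longleftrightarrow>
     (\<forall>A\<in>principal_congruence N. \<forall>z\<in>uhp. eval_mero f (moebius A z) = eval_mero f z) \<and>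
     (\<forall>B\<in>SL2Z. \<exists>F. has_q_expansion N (\<lambda>z. eval_mero f (moebius B z)) F)"

text \<open>The field generated by a primitive $N$-th root of unity, as a subfield of the complex numbers.\<close>

definition cyclotomic_field :: "nat \<Rightarrow> complex set" where
  "cyclotomic_field N =
     (let \<zeta> = cis (2 * pi / of_nat N)
      in {poly (map_poly of_rat a) \<zeta> / poly (map_poly of_rat b) \<zeta> | a b :: rat poly. True})"

definition modular_field :: "nat \<Rightarrow> mero_uhp set" where
  "modular_field N = {f. has_level N f \<and>
     (\<exists>F. has_q_expansion N (eval_mero f) F \<and> (\<forall>n. fls_nth F n \<in> cyclotomic_field N))}"


section \<open>The $j$-function\<close>

definition eisenstein_G :: "nat \<Rightarrow> complex \<Rightarrow> complex" where
  "eisenstein_G k z = (\<Sum>\<^sub>\<infinity>(m,n)\<in>UNIV - {(0, 0)}. 1 / (of_int m * z + of_int n) ^ k)"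

definition weierstrass_g2 :: "complex \<Rightarrow> complex" where
  "weierstrass_g2 z = 60 * eisenstein_G 4 z"

definition weierstrass_g3 :: "complex \<Rightarrow> complex" where
  "weierstrass_g3 z = 140 * eisenstein_G 6 z"

definition klein_j :: mero_uhp where
  "klein_j = mero_of (\<lambda>z. 1728 * weierstrass_g2 z ^ 3 /
                            (weierstrass_g2 z ^ 3 - 27 * weierstrass_g3 z ^ 2))"

lemma summable_int_square: "(\<lambda>n::int. 1 / (1 + real_of_int n ^ 2)) summable_on UNIV"
proof -
  have "summable (\<lambda>n. 1 / (1 + real n ^ 2))"
  proof (rule summable_comparison_test_ev)
    show "summable (\<lambda>n. 1 / real n ^ 2)"
      using inverse_power_summable[of 2, where ?'a = real] by (simp add: field_simps)
    show "eventually (\<lambda>n. norm (1 / (1 + real n ^ 2)) \<le> 1 / real n ^ 2) sequentially"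
      using eventually_gt_at_top[of 0] by eventually_elim (auto intro!: divide_left_mono mult_pos_pos add_pos_nonneg)
  qed
  hence 1: "(\<lambda>n. 1 / (1 + real n ^ 2)) summable_on UNIV"
    by (subst summable_on_UNIV_nonneg_real_iff) auto
  have "(\<lambda>n::int. 1 / (1 + real_of_int n ^ 2)) summable_on range int"
    using 1 by (subst summable_on_reindex) (auto simp: o_def)
  moreover have "(\<lambda>n::int. 1 / (1 + real_of_int n ^ 2)) summable_on range (\<lambda>n. - int n)"
    using 1 by (subst summable_on_reindex) (auto simp: o_def inj_def)
  ultimately have "(\<lambda>n::int. 1 / (1 + real_of_int n ^ 2)) summable_on
                     (range int \<union> (range (\<lambda>n. - int n) - range int))"
    by (intro summable_on_Un_disjoint) (auto intro: summable_on_subset_banach)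
  also have "range int \<union> (range (\<lambda>n. - int n) - range int) = UNIV"
    by (auto, metis int_cases2 rangeI)
  finally show ?thesis .
qed

lemma summable_lattice:
  "(\<lambda>(m::int, n::int). 1 / ((1 + real_of_int m ^ 2) * (1 + real_of_int n ^ 2))) summable_on UNIV"
proof -
  let ?h = "\<lambda>n::int. 1 / (1 + real_of_int n ^ 2)"
  have "(\<lambda>(m, n). ?h m * ?h n) summable_on (UNIV \<times> UNIV)"
  proof (rule summable_on_SigmaI[where g = "\<lambda>m. ?h m * infsum ?h UNIV"])
    show "((\<lambda>n. case (m, n) of (m, n) \<Rightarrow> ?h m * ?h n) has_sum ?h m * infsum ?h UNIV) UNIV" for m
      unfolding prod.case
      by (intro has_sum_cmult_right has_sum_infsum summable_int_square)
    show "(\<lambda>m. ?h m * infsum ?h UNIV) summable_on UNIV"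
      by (intro summable_on_cmult_left summable_int_square)
  qed auto
  thus ?thesis by (simp add: case_prod_unfold)
qed

lemma lattice_lower_bound:
  assumes "\<bar>Re z\<bar> \<le> R" "Im z \<ge> \<delta>" "\<delta> > 0"
  shows   "real_of_int m ^ 2 + real_of_int n ^ 2 \<le>
             (2 + (1 + 2 * R ^ 2) / \<delta> ^ 2) * norm (of_int m * z + of_int n) ^ 2"
proof -
  define x y where "x = Re z" and "y = Im z"
  define u v where "u = real_of_int m * x + real_of_int n" and "v = real_of_int m * y"
  have norm: "norm (of_int m * z + of_int n) ^ 2 = u ^ 2 + v ^ 2"
    by (simp add: cmod_power2 u_def v_def x_def y_def)
  have x: "x ^ 2 \<le> R ^ 2"
    using assms(1) by (simp add: x_def abs_le_square_iff[symmetric])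
  have y: "\<delta> ^ 2 \<le> y ^ 2"
    using assms(2,3) by (simp add: y_def power_mono)
  have "real_of_int n ^ 2 \<le> 2 * u ^ 2 + 2 * (real_of_int m * x) ^ 2"
  proof -
    have "0 \<le> (u + real_of_int m * x) ^ 2" by simp
    thus ?thesis by (simp add: u_def power2_eq_square algebra_simps)
  qed
  moreover have "(real_of_int m * x) ^ 2 \<le> real_of_int m ^ 2 * R ^ 2"
    using x by (simp add: power_mult_distrib mult_left_mono)
  ultimately have "real_of_int m ^ 2 + real_of_int n ^ 2 \<le>
                     2 * u ^ 2 + (1 + 2 * R ^ 2) * real_of_int m ^ 2"
    by (simp add: algebra_simps)
  also have "real_of_int m ^ 2 \<le> v ^ 2 / \<delta> ^ 2"
  proof -
    have "real_of_int m ^ 2 * \<delta> ^ 2 \<le> real_of_int m ^ 2 * y ^ 2"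
      using y by (intro mult_left_mono) auto
    thus ?thesis
      using assms(3) by (simp add: v_def power_mult_distrib field_simps)
  qed
  hence "2 * u ^ 2 + (1 + 2 * R ^ 2) * real_of_int m ^ 2 \<le>
           2 * u ^ 2 + (1 + 2 * R ^ 2) * (v ^ 2 / \<delta> ^ 2)"
    by (intro add_left_mono mult_left_mono) auto
  also have "\<dots> \<le> (2 + (1 + 2 * R ^ 2) / \<delta> ^ 2) * (u ^ 2 + v ^ 2)"
  proof -
    define k where "k = (1 + 2 * R ^ 2) / \<delta> ^ 2"
    have "k \<ge> 0" by (simp add: k_def)
    hence "2 * u ^ 2 + k * v ^ 2 \<le> (2 + k) * (u ^ 2 + v ^ 2)"
      by (simp add: algebra_simps)
    thus ?thesis by (simp add: k_def)
  qed
  finally show ?thesis by (simp add: norm)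
qed

lemma eisenstein_G_holomorphic:
  assumes "l \<ge> 2"
  shows   "eisenstein_G (2 * l) holomorphic_on uhp"
proof -
  have "eisenstein_G (2 * l) analytic_on {z0}" if z0: "z0 \<in> uhp" for z0
  proof -
    define \<delta> where "\<delta> = Im z0 / 2"
    define R where "R = \<bar>Re z0\<bar> + \<delta>"
    define K where "K = 2 + (1 + 2 * R ^ 2) / \<delta> ^ 2"
    define M where "M = (\<lambda>(m::int, n::int). 3 * K ^ l *
                           (1 / ((1 + real_of_int m ^ 2) * (1 + real_of_int n ^ 2))))"
    let ?f = "\<lambda>(m::int, n::int) z. 1 / (of_int m * z + of_int n :: complex) ^ (2 * l)"
    have \<delta>: "\<delta> > 0" using z0 by (simp add: \<delta>_def uhp_def)
    have K: "K > 0" unfolding K_def using \<delta> by (intro add_pos_nonneg) auto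
    have bounds: "\<bar>Re z\<bar> \<le> R" "Im z \<ge> \<delta>" if "z \<in> cball z0 \<delta>" for z
    proof -
      have "norm (z0 - z) \<le> \<delta>" using that by (simp add: dist_norm)
      hence "\<bar>Re (z0 - z)\<bar> \<le> \<delta>" "\<bar>Im (z0 - z)\<bar> \<le> \<delta>"
        using abs_Re_le_cmod[of "z0 - z"] abs_Im_le_cmod[of "z0 - z"] by linarith+
      thus "\<bar>Re z\<bar> \<le> R" "Im z \<ge> \<delta>" by (auto simp: R_def \<delta>_def abs_if split: if_splits)
    qed
    have pos: "real_of_int m ^ 2 + real_of_int n ^ 2 \<ge> 1" if "(m, n) \<noteq> (0, 0)" for m n :: int
    proof -
      have "m ^ 2 + n ^ 2 \<noteq> 0" using that by (simp add: sum_power2_eq_zero_iff)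
      moreover have "m ^ 2 + n ^ 2 \<ge> 0" by simp
      ultimately have "1 \<le> m ^ 2 + n ^ 2" by linarith
      hence "real_of_int 1 \<le> real_of_int (m ^ 2 + n ^ 2)" by (subst of_int_le_iff)
      thus ?thesis by simp
    qed
    have nz: "of_int m * z + of_int n \<noteq> (0 :: complex)"
      if "(m, n) \<noteq> (0, 0)" "z \<in> cball z0 \<delta>" for m n :: int and z
      using lattice_lower_bound[OF bounds[OF that(2)] \<delta>, of m n] pos[OF that(1)] by auto
    have ulim: "uniform_limit (cball z0 \<delta>) (\<lambda>X z. \<Sum>x\<in>X. ?f x z)
            (\<lambda>z. \<Sum>\<^sub>\<infinity>x\<in>UNIV-{(0,0)}. ?f x z) (finite_subsets_at_top (UNIV - {(0,0)}))"
    proof (rule Weierstrass_m_test_general)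
      show "M summable_on (UNIV - {(0, 0)})"
      proof (rule summable_on_subset_banach)
        show "M summable_on UNIV"
          using summable_on_cmult_right[OF summable_lattice, of "3 * K ^ l"]
          by (simp add: M_def case_prod_unfold)
      qed auto
    next
      fix p z assume p: "p \<in> UNIV - {(0::int, 0::int)}" and z: "z \<in> cball z0 \<delta>"
      obtain m n where [simp]: "p = (m, n)" by (cases p)
      define s where "s = real_of_int m ^ 2 + real_of_int n ^ 2"
      define t where "t = norm (of_int m * z + of_int n)"
      have s1: "s \<ge> 1" using pos[of m n] p by (auto simp: s_def)
      have t0: "t > 0" using nz[OF _ z, of m n] p by (auto simp: t_def)
      have st: "s \<le> K * t ^ 2"
        using lattice_lower_bound[OF bounds[OF z] \<delta>, of m n] by (simp add: s_def t_def K_def)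
      have "(1 + real_of_int m ^ 2) * (1 + real_of_int n ^ 2) \<le> 1 + s + s ^ 2"
      proof -
        have "0 \<le> real_of_int m ^ 4 + real_of_int m ^ 2 * real_of_int n ^ 2 + real_of_int n ^ 4"
          by (intro add_nonneg_nonneg mult_nonneg_nonneg) auto
        thus ?thesis
          by (simp add: s_def power2_eq_square power4_eq_xxxx algebra_simps)
      qed
      also have "\<dots> \<le> 3 * s ^ 2"
      proof -
        have "s \<le> s ^ 2" using s1 by (simp add: power2_eq_square)
        thus ?thesis using s1 by linarith
      qed
      also have "\<dots> \<le> 3 * s ^ l"
        using s1 assms by (intro mult_left_mono power_increasing) auto
      also have "\<dots> \<le> 3 * (K * t ^ 2) ^ l"
        using s1 st by (intro mult_left_mono power_mono) auto
      also have "\<dots> = 3 * K ^ l * t ^ (2 * l)"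
        by (simp add: power_mult_distrib power_mult)
      finally have le: "(1 + real_of_int m ^ 2) * (1 + real_of_int n ^ 2) \<le> 3 * K ^ l * t ^ (2 * l)" .
      have "(1 + real_of_int m ^ 2) * (1 + real_of_int n ^ 2) > 0"
        by (intro mult_pos_pos add_pos_nonneg) auto
      hence "1 / t ^ (2 * l) \<le> 3 * K ^ l * (1 / ((1 + real_of_int m ^ 2) * (1 + real_of_int n ^ 2)))"
        using le t0 by (simp add: divide_simps)
      thus "norm (?f p z) \<le> M p"
        by (simp add: M_def t_def norm_divide norm_power)
    qed
    have cont: "\<forall>\<^sub>F X in finite_subsets_at_top (UNIV - {(0::int,0::int)}).
        continuous_on (cball z0 \<delta>) (\<lambda>z. \<Sum>x\<in>X. ?f x z) \<and>
        (\<lambda>z. \<Sum>x\<in>X. ?f x z) holomorphic_on ball z0 \<delta>"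
    proof (rule eventually_finite_subsets_at_top_weakI)
      fix X assume X: "finite X" "X \<subseteq> UNIV - {(0::int,0::int)}"
      have "(\<lambda>z. \<Sum>x\<in>X. ?f x z) holomorphic_on cball z0 \<delta>"
        unfolding case_prod_unfold
      proof (intro holomorphic_intros)
        fix p z assume "p \<in> X" "z \<in> cball z0 \<delta>"
        moreover from this X have "(fst p, snd p) \<noteq> (0, 0)" by auto
        ultimately show "(of_int (fst p) * z + of_int (snd p)) ^ (2 * l) \<noteq> (0 :: complex)"
          using nz[of "fst p" "snd p" z] by simp
      qed
      thus "continuous_on (cball z0 \<delta>) (\<lambda>z. \<Sum>x\<in>X. ?f x z) \<and>
            (\<lambda>z. \<Sum>x\<in>X. ?f x z) holomorphic_on ball z0 \<delta>"
        by (meson ball_subset_cball holomorphic_on_imp_continuous_on holomorphic_on_subset)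
    qed
    have "(\<lambda>z. \<Sum>\<^sub>\<infinity>x\<in>UNIV-{(0,0)}. ?f x z) holomorphic_on ball z0 \<delta>"
      by (rule holomorphic_uniform_limit[OF cont ulim finite_subsets_at_top_neq_bot])
    hence "eisenstein_G (2 * l) holomorphic_on ball z0 \<delta>"
      unfolding eisenstein_G_def by (simp add: case_prod_unfold)
    thus ?thesis
      using \<delta> by (auto simp: analytic_at intro!: exI[of _ "ball z0 \<delta>"])
  qed
  hence "eisenstein_G (2 * l) analytic_on uhp"
    using analytic_on_analytic_at by blast
  thus ?thesis
    by (rule analytic_imp_holomorphic)
qed

text \<open>In particular, the value of \<^const>\<open>mero_of\<close> in the definition of $j$ is not the dummy.\<close>

lemma klein_j_meromorphic:
  "(\<lambda>z. 1728 * weierstrass_g2 z ^ 3 / (weierstrass_g2 z ^ 3 - 27 * weierstrass_g3 z ^ 2))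
     meromorphic_on uhp"
proof -
  have "eisenstein_G 4 meromorphic_on uhp" "eisenstein_G 6 meromorphic_on uhp"
    using eisenstein_G_holomorphic[of 2] eisenstein_G_holomorphic[of 3]
    by (auto intro!: analytic_on_imp_meromorphic_on simp: analytic_on_open open_uhp)
  thus ?thesis
    unfolding weierstrass_g2_def weierstrass_g3_def by (intro meromorphic_intros)
qed


section \<open>Modular units\<close>

definition Z_adjoin_j :: "mero_uhp set" where
  "Z_adjoin_j = {poly (map_poly of_int a) klein_j | a :: int poly. True}"

definition integral_over :: "'a :: comm_ring_1 set \<Rightarrow> 'a \<Rightarrow> bool" where
  "integral_over A x \<longleftrightarrow> (\<exists>P. lead_coeff P = 1 \<and> (\<forall>i. coeff P i \<in> A) \<and> poly P x = 0)"

definition modular_ring :: "nat \<Rightarrow> mero_uhp set" where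
  "modular_ring N = {f \<in> modular_field N. integral_over Z_adjoin_j f}"

definition modular_units :: "nat \<Rightarrow> mero_uhp set" where
  "modular_units N = {f \<in> modular_ring N. \<exists>g\<in>modular_ring N. f * g = 1}"

end

theory Submission
  imports Defs
begin

text \<open>
  If \<open>A\<close> lies in $\Gamma(N)$, then $g \circ A = c\, g$ for a $p$-th root of unity \<open>c\<close>, so \<open>g\<close> is
  invariant under $A^p$. In particular \<open>g\<close> is invariant under all $SL_2(Z)$-conjugates of the
  translation by $pN$, and also under $\Gamma(M)$. By Wohlfahrt's theorem these two sets generate
  a group containing $\Gamma(pN)$. The $q$-expansions of level \<open>M\<close> descend to level $pN$ because
  invariance under translation by $pN$ kills all coefficients that do not occur at that level.
\<close>

section \<open>Two-by-two integer matrices and parabolic elements\<close>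

definition mat2 :: "int \<Rightarrow> int \<Rightarrow> int \<Rightarrow> int \<Rightarrow> int ^ 2 ^ 2" where
  "mat2 a b c d = vector [vector [a, b], vector [c, d]]"

lemma mat2_nth [simp]:
  "mat2 a b c d $ 1 $ 1 = a" "mat2 a b c d $ 1 $ 2 = b"
  "mat2 a b c d $ 2 $ 1 = c" "mat2 a b c d $ 2 $ 2 = d"
  by (simp_all add: mat2_def)

lemma mat2_cases: "\<exists>a b c d. A = mat2 a b c d"
  by (rule exI[of _ "A $ 1 $ 1"], rule exI[of _ "A $ 1 $ 2"],
      rule exI[of _ "A $ 2 $ 1"], rule exI[of _ "A $ 2 $ 2"])
     (simp add: vec_eq_iff forall_2)

lemma mat2_mult:
  "mat2 a b c d ** mat2 a' b' c' d' =
     mat2 (a * a' + b * c') (a * b' + b * d') (c * a' + d * c') (c * b' + d * d')"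
  by (simp add: vec_eq_iff forall_2 matrix_matrix_mult_def sum_2)

lemma mat1_eq_mat2: "mat 1 = mat2 1 0 0 1"
  by (simp add: vec_eq_iff forall_2 mat_def)

lemma mat2_in_SL2Z_iff: "mat2 a b c d \<in> SL2Z \<longleftrightarrow> a * d - b * c = 1"
  by (simp add: SL2Z_def det_2)

lemma mat2_in_principal_congruenceI:
  assumes "a * d - b * c = 1" "int N dvd a - 1" "int N dvd b" "int N dvd c" "int N dvd d - 1"
  shows   "mat2 a b c d \<in> principal_congruence N"
  using assms
  by (auto simp: principal_congruence_def mat2_in_SL2Z_iff forall_2 mat_def cong_iff_dvd_diff)

lemma SL2Z_mult: "A \<in> SL2Z \<Longrightarrow> B \<in> SL2Z \<Longrightarrow> A ** B \<in> SL2Z"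
  by (simp add: SL2Z_def det_mul)

text \<open>The conjugate of the translation by \<open>j\<close> by a matrix with first column \<open>(\<alpha>, \<gamma>)\<close>.\<close>

definition parab :: "int \<Rightarrow> int \<Rightarrow> int \<Rightarrow> int ^ 2 ^ 2" where
  "parab \<alpha> \<gamma> j = mat2 (1 - \<alpha> * \<gamma> * j) (\<alpha> ^ 2 * j) (- (\<gamma> ^ 2) * j) (1 + \<alpha> * \<gamma> * j)"

text \<open>The matrix is the identity plus \<open>j\<close> times a fixed matrix of trace and
  determinant zero. That matrix has square zero, so the parameters add up.\<close>

lemma parab_mult: "parab \<alpha> \<gamma> j ** parab \<alpha> \<gamma> k = parab \<alpha> \<gamma> (j + k)"
  by (simp add: parab_def mat2_mult power2_eq_square algebra_simps)

lemma parab_funpow: "(((**) (parab \<alpha> \<gamma> j)) ^^ n) (mat 1) = parab \<alpha> \<gamma> (int n * j)"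
proof (induction n)
  case 0
  show ?case by (simp add: parab_def mat1_eq_mat2)
qed (simp add: parab_mult algebra_simps)

lemma parab_in_principal_congruence: "parab \<alpha> \<gamma> (int N * j) \<in> principal_congruence N"
  unfolding parab_def
  by (rule mat2_in_principal_congruenceI) (simp_all add: power2_eq_square algebra_simps)

section \<open>Wohlfahrt's theorem\<close>

text \<open>Take for \<open>k\<close> the product of the primes that divide \<open>m\<close> but not
  \<open>a\<close>. A prime factor of \<open>m\<close> that divides \<open>a\<close> divides neither
  \<open>b\<close> nor \<open>k\<close>; any other one divides \<open>k\<close> but not
  \<open>a\<close>. Either way it does not divide \<open>a + k * b\<close>.\<close>

lemma exists_coprime_shift:
  fixes a b m :: int
  assumes "coprime a b" "m \<noteq> 0"
  shows   "\<exists>k. coprime (a + k * b) m"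
proof -
  define S where "S = {l \<in> prime_factors m. \<not> l dvd a}"
  have fin: "finite S" by (simp add: S_def)
  have "coprime (a + \<Prod>S * b) m"
  proof (rule ccontr)
    assume "\<not> coprime (a + \<Prod>S * b) m"
    then obtain c where c: "c dvd a + \<Prod>S * b" "c dvd m" "\<not> is_unit c"
      by (auto simp: coprime_def)
    have "c \<noteq> 0" using c(2) assms(2) by auto
    then obtain l where l: "prime l" "l dvd c"
      using prime_divisor_exists[of c] c(3) by auto
    have ld: "l dvd a + \<Prod>S * b" "l dvd m" using l c dvd_trans by blast+
    have lm: "l \<in> prime_factors m"
      using l ld assms(2) by (auto simp: prime_factors_dvd)
    show False
    proof (cases "l dvd a")
      case True
      hence "l dvd \<Prod>S * b" using ld(1) dvd_add_right_iff by blast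
      moreover have "\<not> l dvd b"
        using True assms(1) l(1) by (meson coprime_common_divisor not_prime_unit)
      ultimately have "l dvd \<Prod>S" using l(1) by (simp add: prime_dvd_mult_iff)
      then obtain q where q: "q \<in> S" "l dvd q"
        using prime_dvd_prod_iff[OF fin l(1), of "\<lambda>x. x"] by auto
      hence "prime q" by (auto simp: S_def)
      hence "l = q" using q(2) l(1) primes_dvd_imp_eq by blast
      thus False using q(1) True by (auto simp: S_def)
    next
      case False
      hence "l \<in> S" using lm by (simp add: S_def)
      hence "l dvd \<Prod>S * b" using fin dvd_prodI[OF fin, of l "\<lambda>x. x"] by simp
      thus False using False ld(1) by (metis dvd_add_left_iff)
    qed
  qed
  thus ?thesis by blast
qed

text \<open>If \<open>x\<close> inverts \<open>a\<close> modulo \<open>m\<close> and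
  \<open>b = L * b'\<close>, the multiplier \<open>- (x * b')\<close> works. It serves to clear an
  off-diagonal entry modulo \<open>M\<close> by means of translations by multiples of
  \<open>L\<close>.\<close>

lemma exists_shift_dvd:
  fixes a b m L :: int
  assumes "coprime a m" "L dvd b"
  shows   "\<exists>x. m dvd b + a * (L * x)"
proof -
  obtain b' where b': "b = L * b'" using assms(2) by auto
  obtain x where "[a * x = 1] (mod m)"
    using assms(1) by (auto simp: coprime_iff_invertible_int)
  hence "m dvd a * x - 1" by (simp add: cong_iff_dvd_diff)
  hence "m dvd (a * x - 1) * (- b)" by (rule dvd_mult2)
  also have "(a * x - 1) * (- b) = b + a * (L * (- (x * b')))"
    by (simp add: b' algebra_simps)
  finally show ?thesis by blast
qed

text \<open>
  This is Wohlfahrt's theorem. Multiplication by translations in \<open>H\<close> from both sides turns a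
  given matrix into one that is diagonal modulo \<open>M\<close>, with upper left entry \<open>u\<close>, say. The same
  process applied to the conjugate \<open>parab 1 1 (1 - u)\<close> of a translation, whose upper left entry is
  also \<open>u\<close>, leads to the same diagonal matrix modulo \<open>M\<close>.
\<close>

lemma principal_congruence_subset_generated:
  fixes H :: "(int ^ 2 ^ 2) set"
  assumes M: "M > 0"
    and mult: "\<And>A B. A \<in> H \<Longrightarrow> B \<in> H \<Longrightarrow> A ** B \<in> H"
    and cong: "principal_congruence M \<subseteq> H"
    and par: "\<And>\<alpha> \<gamma> j. parab \<alpha> \<gamma> (L * j) \<in> H"
    and det: "a * d - b * c = 1"
    and dvd: "L dvd a - 1" "L dvd b" "L dvd c"
  shows "mat2 a b c d \<in> H"
proof -
  have T: "mat2 1 (L * x) 0 1 \<in> H" for x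
    using par[of 1 0 x] by (simp add: parab_def)
  \<comment> \<open>The sign makes up for the lower left entry \<open>- (\<gamma> ^ 2) * j\<close>
    of \<open>parab\<close>.\<close>
  have U: "mat2 1 0 (L * y) 1 \<in> H" for y
    using par[of 0 1 "- y"] by (simp add: parab_def)

  \<comment> \<open>These row and column operations keep the upper left entry \<open>u\<close>.
    Since \<open>u\<close> is invertible modulo \<open>M\<close>, suitable multiples of
    \<open>L\<close> make both off-diagonal entries vanish modulo \<open>M\<close>.\<close>
  have clear: "\<exists>x y. mat2 1 0 (L * y) 1 ** mat2 u b c d ** mat2 1 (L * x) 0 1 =
                   mat2 u (b + u * (L * x)) (c + u * (L * y))
                     (d + c * (L * x) + (L * y) * (b + u * (L * x))) \<and>
                 int M dvd b + u * (L * x) \<and> int M dvd c + u * (L * y)"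
    if "coprime u (int M)" "L dvd b" "L dvd c" for u b c d
  proof -
    obtain x where x: "int M dvd b + u * (L * x)"
      using exists_shift_dvd \<open>coprime u (int M)\<close> \<open>L dvd b\<close> by blast
    obtain y where y: "int M dvd c + u * (L * y)"
      using exists_shift_dvd \<open>coprime u (int M)\<close> \<open>L dvd c\<close> by blast
    show ?thesis
      by (rule exI[of _ x], rule exI[of _ y]) (use x y in \<open>simp add: mat2_mult algebra_simps\<close>)
  qed

  have diag: "mat2 u b2 c2 d2 \<in> H"
    if "mat2 u b3 c3 d3 \<in> H" "u * d2 - b2 * c2 = 1" "u * d3 - b3 * c3 = 1"
      "int M dvd b2" "int M dvd c2" "int M dvd b3" "int M dvd c3" for u b2 c2 d2 b3 c3 d3
  proof -
    \<comment> \<open>The second factor is the adjugate, hence the inverse, of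
      \<open>mat2 u b3 c3 d3\<close>, so \<open>C\<close> is a quotient. By the two determinants
      \<open>u * d2\<close> and \<open>u * d3\<close> are congruent to 1 modulo \<open>M\<close>,
      which puts \<open>C\<close> into \<open>principal_congruence M\<close>.\<close>
    define C where "C = mat2 u b2 c2 d2 ** mat2 d3 (- b3) (- c3) u"
    have "C = mat2 (u * d3 - b2 * c3) (u * b2 - u * b3) (c2 * d3 - d2 * c3) (u * d2 - c2 * b3)"
      by (simp add: C_def mat2_mult algebra_simps)
    also have "\<dots> \<in> principal_congruence M"
    proof (rule mat2_in_principal_congruenceI)
      show "(u * d3 - b2 * c3) * (u * d2 - c2 * b3) - (u * b2 - u * b3) * (c2 * d3 - d2 * c3) = 1"
      proof -
        have "(u * d3 - b2 * c3) * (u * d2 - c2 * b3) - (u * b2 - u * b3) * (c2 * d3 - d2 * c3) =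
                (u * d2 - b2 * c2) * (u * d3 - b3 * c3)"
          by (simp add: algebra_simps)
        thus ?thesis using that by simp
      qed
      have eq: "u * d3 - b2 * c3 - 1 = b3 * c3 - b2 * c3" "u * d2 - c2 * b3 - 1 = b2 * c2 - c2 * b3"
        using that(2,3) by simp_all
      show "int M dvd u * d3 - b2 * c3 - 1" "int M dvd u * d2 - c2 * b3 - 1"
        unfolding eq using that by simp_all
    qed (use that in simp_all)
    finally have "C \<in> H" using cong by blast
    hence "C ** mat2 u b3 c3 d3 \<in> H" using mult that(1) by blast
    also have "C ** mat2 u b3 c3 d3 = mat2 u b2 c2 d2"
    proof -
      have "mat2 d3 (- b3) (- c3) u ** mat2 u b3 c3 d3 = mat 1"
        using that(3) by (simp add: mat2_mult mat1_eq_mat2 algebra_simps)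
      thus ?thesis by (simp add: C_def flip: matrix_mul_assoc)
    qed
    finally show ?thesis .
  qed

  have main: "mat2 u b c d \<in> H"
    if u: "coprime u (int M)" "u * d - b * c = 1" "L dvd u - 1" "L dvd b" "L dvd c" for u b c d
  proof -
    obtain t where "u - 1 = L * t" using u(3) by (rule dvdE)
    hence t: "u = 1 + L * t" by simp
    \<comment> \<open>This is \<open>parab 1 1 (1 - u)\<close>, and \<open>L\<close> divides
      \<open>1 - u\<close>.\<close>
    have X: "mat2 u (1 - u) (u - 1) (2 - u) \<in> H"
      using par[of 1 1 "- t"] by (simp add: parab_def t)
    have L': "L dvd 1 - u" using u(3) by (subst dvd_diff_commute)
    obtain x y where xy:
      "mat2 1 0 (L * y) 1 ** mat2 u b c d ** mat2 1 (L * x) 0 1 =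
         mat2 u (b + u * (L * x)) (c + u * (L * y))
           (d + c * (L * x) + (L * y) * (b + u * (L * x)))"
      "int M dvd b + u * (L * x)" "int M dvd c + u * (L * y)"
      using clear[OF u(1,4,5)] by blast
    obtain x' y' where xy':
      "mat2 1 0 (L * y') 1 ** mat2 u (1 - u) (u - 1) (2 - u) ** mat2 1 (L * x') 0 1 =
         mat2 u (1 - u + u * (L * x')) (u - 1 + u * (L * y'))
           (2 - u + (u - 1) * (L * x') + (L * y') * (1 - u + u * (L * x')))"
      "int M dvd 1 - u + u * (L * x')" "int M dvd u - 1 + u * (L * y')"
      using clear[OF u(1) L' u(3)] by blast
    have "mat2 u (1 - u + u * (L * x')) (u - 1 + u * (L * y'))
           (2 - u + (u - 1) * (L * x') + (L * y') * (1 - u + u * (L * x'))) \<in> H"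
      unfolding xy'(1)[symmetric] by (intro mult T U X)
    moreover have "u * (d + c * (L * x) + (L * y) * (b + u * (L * x))) -
            (b + u * (L * x)) * (c + u * (L * y)) = 1"
      using u(2) by (simp add: algebra_simps)
    moreover have "u * (2 - u + (u - 1) * (L * x') + (L * y') * (1 - u + u * (L * x'))) -
            (1 - u + u * (L * x')) * (u - 1 + u * (L * y')) = 1"
      by (simp add: algebra_simps)
    ultimately have "mat2 u (b + u * (L * x)) (c + u * (L * y))
           (d + c * (L * x) + (L * y) * (b + u * (L * x))) \<in> H"
      by (rule diag) (rule xy xy')+
    hence "mat2 1 0 (L * y) 1 ** mat2 u b c d ** mat2 1 (L * x) 0 1 \<in> H"
      unfolding xy(1) .
    \<comment> \<open>The inverse elementary matrices undo the clearing.\<close>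
    hence "mat2 1 0 (L * (- y)) 1 ** (mat2 1 0 (L * y) 1 ** mat2 u b c d ** mat2 1 (L * x) 0 1) **
             mat2 1 (L * (- x)) 0 1 \<in> H"
      by (rule mult[OF mult[OF U] T])
    thus ?thesis by (simp add: mat2_mult algebra_simps)
  qed

  \<comment> \<open>It remains to reach an upper left entry coprime to \<open>M\<close>. Adding
    \<open>k * L\<close> times the second row to the first turns \<open>a\<close> into
    \<open>a + k * (c * L)\<close>, and a suitable \<open>k\<close> exists once \<open>a\<close> is
    coprime to \<open>c * L\<close>: to \<open>c\<close> by the determinant, to \<open>L\<close>
    because \<open>a\<close> is 1 modulo \<open>L\<close>.\<close>
  have "coprime a (c * L)"
  proof -
    have "coprime a c"
    proof (rule coprimeI)
      fix e assume "e dvd a" "e dvd c"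
      hence "e dvd a * d - b * c" by simp
      thus "is_unit e" using det by simp
    qed
    moreover have "coprime a L"
    proof (rule coprimeI)
      fix e assume "e dvd a" "e dvd L"
      hence "e dvd a - (a - 1)" using dvd(1) dvd_trans dvd_diff by blast
      thus "is_unit e" by simp
    qed
    ultimately show ?thesis by simp
  qed
  then obtain k where k: "coprime (a + k * (c * L)) (int M)"
    using exists_coprime_shift[of a "c * L" "int M"] M by auto
  have "mat2 (a + k * (c * L)) (b + k * L * d) c d \<in> H"
  proof (rule main)
    show "(a + k * (c * L)) * d - (b + k * L * d) * c = 1"
      using det by (simp add: algebra_simps)
    have "a + k * (c * L) - 1 = (a - 1) + L * (k * c)" by simp
    thus "L dvd a + k * (c * L) - 1" using dvd(1) by (metis dvd_add dvd_triv_left)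
  qed (use k dvd in auto)
  hence "mat2 1 (L * (- k)) 0 1 ** mat2 (a + k * (c * L)) (b + k * L * d) c d \<in> H"
    by (intro mult T)
  thus ?thesis by (simp add: mat2_mult algebra_simps)
qed


section \<open>The action on the upper half plane\<close>

lemma moebius_denom_nonzero:
  fixes A :: "int ^ 2 ^ 2"
  assumes "z \<in> uhp" "A \<in> SL2Z"
  shows   "of_int (A $ 2 $ 1) * z + of_int (A $ 2 $ 2) \<noteq> 0"
proof
  assume eq: "of_int (A $ 2 $ 1) * z + of_int (A $ 2 $ 2) = 0"
  hence "Im (of_int (A $ 2 $ 1) * z + of_int (A $ 2 $ 2)) = 0" by simp
  hence "A $ 2 $ 1 = 0" using assms(1) by (auto simp: uhp_def)
  with eq have "A $ 2 $ 2 = 0" by simp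
  with \<open>A $ 2 $ 1 = 0\<close> show False using assms(2) by (simp add: SL2Z_def det_2)
qed

lemma moebius_in_uhp:
  assumes "z \<in> uhp" "A \<in> SL2Z"
  shows   "moebius A z \<in> uhp"
proof -
  define a b c d where "a = real_of_int (A $ 1 $ 1)" and "b = real_of_int (A $ 1 $ 2)"
    and "c = real_of_int (A $ 2 $ 1)" and "d = real_of_int (A $ 2 $ 2)"
  have "A $ 1 $ 1 * A $ 2 $ 2 - A $ 1 $ 2 * A $ 2 $ 1 = 1"
    using assms(2) by (simp add: SL2Z_def det_2)
  hence "real_of_int (A $ 1 $ 1 * A $ 2 $ 2 - A $ 1 $ 2 * A $ 2 $ 1) = 1" by simp
  hence det: "a * d - b * c = 1" by (simp add: a_def b_def c_def d_def)
  have nz: "of_real c * z + of_real d \<noteq> 0"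
    using moebius_denom_nonzero[OF assms] by (simp add: c_def d_def)
  have "Im (moebius A z) = Im z * (a * d - b * c) / norm (of_real c * z + of_real d) ^ 2"
    by (simp add: moebius_def Im_divide cmod_power2 a_def b_def c_def d_def algebra_simps)
  thus ?thesis
    using assms(1) nz by (simp add: uhp_def det)
qed

lemma moebius_mult:
  assumes "z \<in> uhp" "B \<in> SL2Z"
  shows   "moebius (A ** B) z = moebius A (moebius B z)"
proof -
  define D where "D = of_int (B $ 2 $ 1) * z + of_int (B $ 2 $ 2)"
  define E where "E = of_int (B $ 1 $ 1) * z + of_int (B $ 1 $ 2)"
  have D: "D \<noteq> 0" using moebius_denom_nonzero[OF assms] by (simp add: D_def)
  have "moebius A (moebius B z) =
          (of_int (A $ 1 $ 1) * (E / D) + of_int (A $ 1 $ 2)) /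
          (of_int (A $ 2 $ 1) * (E / D) + of_int (A $ 2 $ 2))"
    by (simp add: moebius_def D_def E_def)
  also have "\<dots> = (of_int (A $ 1 $ 1) * E + of_int (A $ 1 $ 2) * D) /
                  (of_int (A $ 2 $ 1) * E + of_int (A $ 2 $ 2) * D)"
  proof -
    have "of_int (A $ 1 $ 1) * (E / D) + of_int (A $ 1 $ 2) =
            (of_int (A $ 1 $ 1) * E + of_int (A $ 1 $ 2) * D) / D"
         "of_int (A $ 2 $ 1) * (E / D) + of_int (A $ 2 $ 2) =
            (of_int (A $ 2 $ 1) * E + of_int (A $ 2 $ 2) * D) / D"
      using D by (simp_all add: field_simps)
    thus ?thesis using D by simp
  qed
  also have "\<dots> = moebius (A ** B) z"
    by (simp add: moebius_def matrix_matrix_mult_def sum_2 D_def E_def algebra_simps)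
  finally show ?thesis ..
qed

lemma moebius_1 [simp]: "moebius (mat 1) z = z"
  by (simp add: moebius_def mat_def)

lemma moebius_uminus: "moebius (- A) z = moebius A z"
proof -
  have "moebius (- A) z =
          (- (of_int (A $ 1 $ 1) * z + of_int (A $ 1 $ 2))) /
          (- (of_int (A $ 2 $ 1) * z + of_int (A $ 2 $ 2)))"
    by (simp add: moebius_def algebra_simps)
  thus ?thesis unfolding minus_divide_divide by (simp add: moebius_def)
qed

lemma holomorphic_on_moebius: "A \<in> SL2Z \<Longrightarrow> moebius A holomorphic_on uhp"
  unfolding moebius_def by (intro holomorphic_intros) (rule moebius_denom_nonzero)

section \<open>Roots of invariant functions\<close>

text \<open>Multiplication in \<open>mero_uhp\<close> removes singularities and a priori agrees with
  the pointwise product only off a sparse set. For holomorphic \<open>g\<close> the pointwise power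
  is analytic, so removing singularities does not change it.\<close>

lemma eval_mero_power:
  assumes "eval_mero g holomorphic_on uhp" "z \<in> uhp"
  shows   "eval_mero (g ^ n) z = eval_mero g z ^ n"
proof -
  have "\<forall>\<^sub>\<approx>w\<in>uhp. eval_mero (g ^ n) w = eval_mero g w ^ n"
  proof (induction n)
    case 0
    show ?case using eval_mero_arith_cosparse(2) by simp
  next
    case (Suc n)
    with eval_mero_arith_cosparse(6)[of g "g ^ n"] show ?case
      by eventually_elim simp
  qed
  hence "eventually (\<lambda>w. eval_mero (g ^ n) w = eval_mero g w ^ n) (at z)"
    using assms(2) by (simp add: eventually_cosparse_open_eq open_uhp)
  hence "remove_sings (eval_mero (g ^ n)) z = remove_sings (\<lambda>w. eval_mero g w ^ n) z"
    by (rule remove_sings_cong) auto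
  moreover have "(\<lambda>w. eval_mero g w ^ n) analytic_on {z}"
  proof -
    have "(\<lambda>w. eval_mero g w ^ n) holomorphic_on uhp"
      by (intro holomorphic_intros assms)
    thus ?thesis using assms(2) open_uhp analytic_at by blast
  qed
  ultimately show ?thesis
    using assms(2) by (simp add: remove_sings_eval_mero)
qed

text \<open>On a ball where \<open>g\<close> has no zero, \<open>h / g\<close> is continuous with
  values among the finitely many \<open>n\<close>-th roots of unity, hence constant. The identity
  theorem carries the relation to all of \<open>S\<close>.\<close>

lemma holomorphic_power_eq_imp_proportional:
  fixes g h :: "complex \<Rightarrow> complex"
  assumes hol: "g holomorphic_on S" "h holomorphic_on S"
    and S: "open S" "connected S"
    and n: "n > 0" and eq: "\<And>z. z \<in> S \<Longrightarrow> h z ^ n = g z ^ n"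
  shows   "\<exists>c. c ^ n = 1 \<and> (\<forall>z\<in>S. h z = c * g z)"
proof (cases "\<forall>z\<in>S. g z = 0")
  case True
  hence "\<forall>z\<in>S. h z = 0" using eq n by (metis power_eq_0_iff)
  thus ?thesis using True by (intro exI[of _ 1]) auto
next
  case False
  then obtain w where w: "w \<in> S" "g w \<noteq> 0" by auto
  have "continuous_on S g" using hol(1) by (rule holomorphic_on_imp_continuous_on)
  hence "open {z \<in> S. g z \<noteq> 0}"
    using continuous_open_preimage[OF _ S(1), of g "- {0}"] by (simp add: vimage_def Int_def open_Compl)
  then obtain r where r: "r > 0" "ball w r \<subseteq> {z \<in> S. g z \<noteq> 0}"
    using w open_contains_ball by (metis (mono_tags, lifting) mem_Collect_eq)
  define q where "q = (\<lambda>z. h z / g z)"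
  have "q constant_on ball w r"
  proof (rule continuous_finite_range_constant)
    have "q holomorphic_on ball w r"
      unfolding q_def using r(2) hol by (intro holomorphic_intros) (auto elim: holomorphic_on_subset)
    thus "continuous_on (ball w r) q" by (rule holomorphic_on_imp_continuous_on)
    have "q ` ball w r \<subseteq> {c. c ^ n = 1}"
      using r(2) eq by (auto simp: q_def power_divide)
    moreover have "finite {c::complex. c ^ n = 1}"
      using n by (intro finite_roots_unity) auto
    ultimately show "finite (q ` ball w r)" by (rule finite_subset)
  qed auto
  then obtain c where c: "\<And>z. z \<in> ball w r \<Longrightarrow> q z = c" by (auto simp: constant_on_def)
  have "h z - c * g z = 0" if "z \<in> S" for z
  proof (rule analytic_continuation[where f = "\<lambda>z. h z - c * g z" and S = S and U = "ball w r" and \<xi> = w])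
    show "(\<lambda>z. h z - c * g z) holomorphic_on S" by (intro holomorphic_intros hol)
    show "h z - c * g z = 0" if "z \<in> ball w r" for z
      using c[OF that] that r(2) by (auto simp: q_def)
    show "w islimpt ball w r" using r(1) by (simp add: islimpt_ball)
  qed (use r(2) S w that in auto)
  moreover have "c ^ n = 1"
    using c[of w] r(1) eq[OF w(1)] w(2) by (auto simp: q_def power_divide)
  ultimately show ?thesis by (intro exI[of _ c]) auto
qed

text \<open>The functions \<open>g\<close> and \<open>g \<circ> A\<close> have the same
  \<open>n\<close>-th power, so they differ by a root of unity \<open>c\<close>. The
  \<open>k\<close>-th power of \<open>A\<close> multiplies \<open>g\<close> by \<open>c ^ k\<close>,
  and \<open>c ^ n = 1\<close>.\<close>

lemma root_invariant_under_power:
  assumes hol: "eval_mero g holomorphic_on uhp" and n: "n > 0" and A: "A \<in> SL2Z"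
    and inv: "\<And>z. z \<in> uhp \<Longrightarrow> eval_mero (g ^ n) (moebius A z) = eval_mero (g ^ n) z"
    and z: "z \<in> uhp"
  shows   "eval_mero g (moebius (((**) A ^^ n) (mat 1)) z) = eval_mero g z"
proof -
  have "(\<lambda>z. eval_mero g (moebius A z)) holomorphic_on uhp"
    using holomorphic_on_compose_gen[OF holomorphic_on_moebius[OF A] hol] moebius_in_uhp[OF _ A]
    by (auto simp: o_def)
  then obtain c where c: "c ^ n = 1" "\<And>z. z \<in> uhp \<Longrightarrow> eval_mero g (moebius A z) = c * eval_mero g z"
    using holomorphic_power_eq_imp_proportional
            [OF hol _ open_uhp connected_uhp n, of "\<lambda>z. eval_mero g (moebius A z)"]
          inv eval_mero_power[OF hol] moebius_in_uhp[OF _ A] by metis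
  have SL: "((**) A ^^ k) (mat 1) \<in> SL2Z" for k
    by (induction k) (auto intro: SL2Z_mult A simp: mat1_eq_mat2 mat2_in_SL2Z_iff)
  have "eval_mero g (moebius (((**) A ^^ k) (mat 1)) z) = c ^ k * eval_mero g z" for k
  proof (induction k)
    case (Suc k)
    have "eval_mero g (moebius (((**) A ^^ Suc k) (mat 1)) z) =
            eval_mero g (moebius A (moebius (((**) A ^^ k) (mat 1)) z))"
      by (simp add: moebius_mult z SL)
    also have "\<dots> = c * eval_mero g (moebius (((**) A ^^ k) (mat 1)) z)"
      by (intro c moebius_in_uhp z SL)
    finally show ?case by (simp add: Suc)
  qed auto
  thus ?thesis by (simp add: c)
qed

section \<open>Changing the level of q-expansions\<close>

lemma has_q_expansionI:
  assumes N: "N > 0" and \<phi>: "\<phi> has_laurent_expansion F"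
    and eq: "\<And>z. Im z > c \<Longrightarrow> f z = \<phi> (exp (2 * pi * \<i> * z / of_nat N))"
  shows   "has_q_expansion N f F"
proof -
  obtain r where r: "r > 0" "\<And>q. q \<noteq> 0 \<Longrightarrow> norm q < r \<Longrightarrow> eval_fls F q = \<phi> q"
    using \<phi> unfolding has_laurent_expansion_def eventually_at by auto
  \<comment> \<open>Since \<open>norm q = exp (- (2 * pi * Im z / N))\<close>, the last bound is
    what \<open>norm q < r\<close> requires; the entry \<open>1\<close> keeps \<open>c'\<close>
    positive.\<close>
  define c' where "c' = max (max c 1) (- ln r * N / (2 * pi))"
  have "f z = eval_fls F (exp (2 * pi * \<i> * z / of_nat N))" if "Im z > c'" for z
  proof -
    have "- ln r * N / (2 * pi) < Im z" using that by (simp add: c'_def)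
    hence "- (2 * pi * Im z / N) < ln r"
      using N by (simp add: field_simps)
    hence "exp (- (2 * pi * Im z / N)) < exp (ln r)" by simp
    hence "norm (exp (2 * pi * \<i> * z / of_nat N)) < r" using r(1) by simp
    thus ?thesis using r(2) eq[of z] that by (simp add: c'_def)
  qed
  moreover have "c' > 0" by (simp add: c'_def)
  ultimately show ?thesis
    using \<phi> unfolding has_q_expansion_def has_laurent_expansion_def by blast
qed

text \<open>The local variable of level \<open>N\<close> is the \<open>k\<close>-th power of that of
  level \<open>k * N\<close>, hence the substitution of \<open>fps_X ^ k\<close>.\<close>

lemma has_q_expansion_lift:
  assumes "has_q_expansion N f F" "N > 0" "k > 0"
  shows   "has_q_expansion (k * N) f (fls_compose_fps F (fps_X ^ k))"
proof -
  obtain c where c: "\<And>z. Im z > c \<Longrightarrow> f z = eval_fls F (exp (2 * pi * \<i> * z / of_nat N))"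
    using assms(1) unfolding has_q_expansion_def by auto
  show ?thesis
  proof (rule has_q_expansionI)
    show "(eval_fls F \<circ> (\<lambda>q. q ^ k)) has_laurent_expansion fls_compose_fps F (fps_X ^ k)"
    proof (rule has_laurent_expansion_compose)
      show "eval_fls F has_laurent_expansion F"
        using assms(1) by (auto simp: has_q_expansion_def intro: eval_fls_has_laurent_expansion)
      show "(\<lambda>q. q ^ k) has_laurent_expansion fps_to_fls (fps_X ^ k)"
        by (auto intro: laurent_expansion_intros simp: fps_to_fls_power)
    qed (use assms in auto)
    show "f z = (eval_fls F \<circ> (\<lambda>q. q ^ k)) (exp (2 * pi * \<i> * z / of_nat (k * N)))" if "Im z > c" for z
      using c[OF that] assms by (simp flip: exp_of_nat_mult add: field_simps)
  qed (use assms in auto)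
qed

text \<open>This reverses the substitution of \<open>q ^ k\<close>: keeping every
  \<open>k\<close>-th coefficient loses only zeros.\<close>

lemma fls_decompose_power:
  fixes F :: "complex fls"
  assumes "k > 0" and conv: "fls_conv_radius F > 0"
    and supp: "\<And>n. fls_nth F n \<noteq> 0 \<Longrightarrow> int k dvd n"
  shows   "\<exists>G. fls_conv_radius G > 0 \<and> (\<forall>q. eval_fls G (q ^ k) = eval_fls F q)"
proof (cases "F = 0")
  case True
  thus ?thesis by (intro exI[of _ 0]) auto
next
  case False
  \<comment> \<open>A nonzero series has a nonzero coefficient at its subdegree, so \<open>k\<close>
    divides the subdegree and the division is exact.\<close>
  define e where "e = fls_subdegree F div int k"
  have d: "fls_subdegree F = int k * e"
    using supp[of "fls_subdegree F"] False by (simp add: e_def)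
  define b where "b = fls_base_factor_to_fps F"
  have b_nth: "fps_nth b n = fls_nth F (int k * e + int n)" for n
    by (simp add: b_def fls_base_factor_to_fps_nth d add_ac)
  have b_supp: "fps_nth b n = 0" if "n \<notin> range (\<lambda>m. k * m)" for n
  proof (rule ccontr)
    assume "fps_nth b n \<noteq> 0"
    hence "int k dvd int k * e + int n" using supp unfolding b_nth by blast
    hence "k dvd n" by (simp add: dvd_add_right_iff)
    with that show False by auto
  qed
  have mono: "strict_mono (\<lambda>m. k * m)" using assms(1) by (simp add: strict_mono_def)
  define B where "B = Abs_fps (\<lambda>m. fps_nth b (k * m))"
  have B_eval: "eval_fps B (q ^ k) = eval_fps b q" for q
    using suminf_mono_reindex[OF mono, of "\<lambda>n. fps_nth b n * q ^ n"] b_supp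
    by (simp add: eval_fps_def B_def power_mult)
  have "fps_conv_radius b > 0" using conv by (simp add: b_def fls_conv_radius_altdef)
  then obtain r where r: "0 < r" "ereal r < fps_conv_radius b"
    using ereal_dense2 by (metis ereal_less(2))
  \<comment> \<open>Convergence of \<open>b\<close> at \<open>r\<close> becomes convergence of
    \<open>B\<close> at \<open>r ^ k\<close>, which bounds the radius of \<open>B\<close> from
    below.\<close>
  have "summable (\<lambda>n. fps_nth b n * of_real r ^ n)"
    using r by (intro summable_fps) simp
  hence "summable (\<lambda>m. fps_nth b (k * m) * of_real r ^ (k * m))"
    using summable_mono_reindex[OF mono, of "\<lambda>n. fps_nth b n * of_real r ^ n"] b_supp by simp
  hence "summable (\<lambda>m. fps_nth B m * (of_real r ^ k) ^ m)"
    by (simp add: B_def power_mult)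
  hence "fps_conv_radius B \<ge> norm (complex_of_real r ^ k)"
    unfolding fps_conv_radius_def by (rule conv_radius_geI)
  moreover have "ereal (norm (complex_of_real r ^ k)) > 0" using r(1) by simp
  ultimately have B_conv: "fps_conv_radius B > 0" by (rule less_le_trans[rotated])
  \<comment> \<open>The shift multiplies by the \<open>e\<close>-th power of the variable. As
    \<open>B\<close> has nonzero constant term, \<open>G\<close> has subdegree \<open>e\<close> and
    base factor \<open>B\<close>, the data from which \<open>eval_fls\<close> is computed.\<close>
  define G where "G = fls_shift (- e) (fps_to_fls B)"
  have b0: "fps_nth b 0 \<noteq> 0" using False by (simp add: b_def)
  have B0: "fls_subdegree (fps_to_fls B) = 0"
    using b0 by (simp add: fls_subdegree_fls_to_fps B_def subdegree_eq_0)
  have "B \<noteq> 0" using b0 by (auto simp: B_def fps_eq_iff intro!: exI[of _ 0])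
  hence Gd: "fls_subdegree G = e" by (simp add: G_def B0)
  have Gb: "fls_base_factor_to_fps G = B"
    by (rule fps_ext) (simp add: fls_base_factor_to_fps_nth Gd, simp add: G_def)
  have "eval_fls G (q ^ k) = eval_fls F q" for q
    unfolding eval_fls_def Gb Gd d B_eval by (simp add: b_def power_int_mult)
  moreover have "fls_conv_radius G > 0" using B_conv by (simp add: G_def)
  ultimately show ?thesis by blast
qed

text \<open>Translating \<open>z\<close> by \<open>N\<close> multiplies the local variable of level
  \<open>k * N\<close> by a primitive \<open>k\<close>-th root of unity \<open>\<omega>\<close>.
  Uniqueness of Laurent expansions then forces \<open>\<omega> powi n = 1\<close> wherever the
  coefficient is nonzero, so only multiples of \<open>k\<close> occur as exponents.\<close>

lemma has_q_expansion_descend: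
  assumes F: "has_q_expansion (k * N) f F" and N: "N > 0" "k > 0"
    and per: "\<And>z. Im z > 0 \<Longrightarrow> f (z + of_nat N) = f z"
  shows   "\<exists>G. has_q_expansion N f G"
proof -
  define \<omega> where "\<omega> = exp (2 * pi * \<i> / of_nat k)"
  obtain c where c: "c > 0"
      "\<And>z. Im z > c \<Longrightarrow> f z = eval_fls F (exp (2 * pi * \<i> * z / of_nat (k * N)))"
    using F unfolding has_q_expansion_def by auto
  have conv: "fls_conv_radius F > 0" using F by (simp add: has_q_expansion_def)
  \<comment> \<open>This is \<open>norm q\<close> on the line \<open>Im z = c\<close>; smaller
    \<open>q\<close> come from points above it.\<close>
  define r where "r = exp (- (2 * pi * c / (k * N)))"
  have inv: "eval_fls F (\<omega> * q) = eval_fls F q" if "q \<noteq> 0" "norm q < r" for q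
  proof -
    \<comment> \<open>A preimage of \<open>q\<close> under the exponential map of level
      \<open>k * N\<close>.\<close>
    define z where "z = of_nat (k * N) * Ln q / (2 * pi * \<i>)"
    have q: "exp (2 * pi * \<i> * z / of_nat (k * N)) = q"
      using that N by (simp add: z_def)
    have "exp (2 * pi * \<i> * (z + of_nat N) / of_nat (k * N)) =
            exp (2 * pi * \<i> * z / of_nat (k * N) + 2 * pi * \<i> / of_nat k)"
      using N by (simp add: field_simps)
    also have "\<dots> = \<omega> * q"
      unfolding exp_add q by (simp add: \<omega>_def)
    finally have \<omega>q: "exp (2 * pi * \<i> * (z + of_nat N) / of_nat (k * N)) = \<omega> * q" .
    have "ln (norm q) < - (2 * pi * c / (k * N))"
      using that by (metis r_def ln_exp ln_less_cancel_iff exp_gt_zero zero_less_norm_iff)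
    moreover have "norm q = exp (- (2 * pi * Im z / (k * N)))"
      by (subst q[symmetric]) (simp add: norm_exp_eq_Re)
    ultimately have "2 * pi * c / (k * N) < 2 * pi * Im z / (k * N)" by simp
    hence z: "Im z > c" using N by (simp add: divide_less_cancel)
    show ?thesis
      using c(2)[of z] c(2)[of "z + of_nat N"] per[of z] z c(1) unfolding q \<omega>q by simp
  qed
  have ev: "eventually (\<lambda>q. (eval_fls F \<circ> (\<lambda>q. \<omega> * q)) q = eval_fls F q) (at 0)"
    unfolding eventually_at using inv by (intro exI[of _ r]) (auto simp: r_def)
  have "(eval_fls F \<circ> (\<lambda>q. \<omega> * q)) has_laurent_expansion fls_compose_fps F (fps_const \<omega> * fps_X)"
  proof (rule has_laurent_expansion_compose)
    show "eval_fls F has_laurent_expansion F"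
      by (rule eval_fls_has_laurent_expansion[OF conv])
    show "(\<lambda>q. \<omega> * q) has_laurent_expansion fps_to_fls (fps_const \<omega> * fps_X)"
      by (auto intro!: laurent_expansion_intros simp: fls_times_fps_to_fls)
  qed (auto simp: \<omega>_def)
  hence "eval_fls F has_laurent_expansion fls_compose_fps F (fps_const \<omega> * fps_X)"
    using has_laurent_expansion_cong[OF ev refl] by simp
  hence eq: "fls_compose_fps F (fps_const \<omega> * fps_X) = F"
    using eval_fls_has_laurent_expansion[OF conv] has_laurent_expansion_unique by blast
  have "int k dvd n" if n: "fls_nth F n \<noteq> 0" for n
  proof -
    have "fls_nth F n * \<omega> powi n = fls_nth F n"
      using fls_nth_fls_compose_fps_linear[of \<omega> F n] eq by (simp add: \<omega>_def)
    hence "\<omega> powi n = 1" using n by simp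
    hence "exp (of_int n * (2 * pi * \<i> / of_nat k)) = 1"
      by (simp add: \<omega>_def exp_power_int)
    then obtain m :: int where "n * (2 * pi) / k = 2 * m * pi"
      by (auto simp: exp_eq_1)
    hence "real_of_int n = real_of_int (m * int k)" using N by (simp add: field_simps)
    hence "n = m * int k" by (simp only: of_int_eq_iff)
    thus ?thesis by simp
  qed
  then obtain G where G: "fls_conv_radius G > 0" "\<And>q. eval_fls G (q ^ k) = eval_fls F q"
    using fls_decompose_power[OF N(2) conv] by blast
  have "has_q_expansion N f G"
  proof (rule has_q_expansionI)
    show "eval_fls G has_laurent_expansion G" by (rule eval_fls_has_laurent_expansion[OF G(1)])
    fix z assume z: "Im z > c"
    have "exp (2 * pi * \<i> * z / of_nat (k * N)) ^ k = exp (2 * pi * \<i> * z / of_nat N)"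
      using N by (simp flip: exp_of_nat_mult add: field_simps)
    thus "f z = eval_fls G (exp (2 * pi * \<i> * z / of_nat N))"
      using c(2)[OF z] G(2) by metis
  qed (use N in auto)
  thus ?thesis by blast
qed

section \<open>Signs of lifts, periods at the cusps, and the level of the root\<close>

text \<open>A lift congruent to minus the identity is replaced by its negative, which acts in the
  same way. The congruence for \<open>d\<close> follows from the determinant.\<close>

lemma principal_congruence_cases:
  assumes "A \<in> principal_congruence L"
  obtains a b c d where "a * d - b * c = 1" "int L dvd a - 1" "int L dvd b" "int L dvd c"
    "A = mat2 a b c d \<or> A = - mat2 a b c d"
proof -
  obtain a b c d where A: "A = mat2 a b c d" using mat2_cases by blast
  have det: "a * d - b * c = 1"
    using assms by (simp add: A principal_congruence_def mat2_in_SL2Z_iff)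
  consider "int L dvd a - 1" "int L dvd b" "int L dvd c"
    | "int L dvd a + 1" "int L dvd b" "int L dvd c"
    using assms by (auto simp: A principal_congruence_def forall_2 mat_def cong_iff_dvd_diff)
  thus thesis
  proof cases
    case 1
    thus thesis using that[of a d b c] det A by blast
  next
    case 2
    have "int L dvd - a - 1" using dvd_minus_iff[of "int L" "a + 1"] 2(1) by simp
    moreover have "A = - mat2 (- a) (- b) (- c) (- d)"
      by (simp add: A vec_eq_iff forall_2)
    ultimately show thesis using that[of "-a" "-d" "-b" "-c"] det 2 by simp
  qed
qed

text \<open>Conjugating the translation by \<open>j\<close> with a matrix of first column
  \<open>(a, c)\<close> gives \<open>parab a c j\<close>. Thus periodicity at an arbitrary cusp is
  invariance under a parabolic element.\<close>

lemma moebius_translation: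
  assumes "mat2 a b c d \<in> SL2Z" "z \<in> uhp"
  shows   "moebius (mat2 a b c d) (z + of_int j) = moebius (parab a c j) (moebius (mat2 a b c d) z)"
proof -
  have det: "a * d = 1 + b * c" using assms(1) by (simp add: mat2_in_SL2Z_iff)
  have "parab a c j ** mat2 a b c d = mat2 a b c d ** mat2 1 j 0 1"
  proof -
    have "- (a * c * j * b) + a\<^sup>2 * j * d = a * j * (a * d - b * c)"
         "- (c\<^sup>2 * j * b) + a * c * j * d = c * j * (a * d - b * c)"
      by (simp_all add: power2_eq_square algebra_simps)
    thus ?thesis using det
      by (simp add: parab_def mat2_mult power2_eq_square algebra_simps)
  qed
  moreover have "moebius (mat2 1 j 0 1) z = z + of_int j" by (simp add: moebius_def)
  ultimately show ?thesis
    using assms by (metis moebius_mult mat2_in_SL2Z_iff mult_1 mult_zero_right diff_zero)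
qed

theorem theorem2p1:
  fixes N p M :: nat and f g :: mero_uhp
  assumes "N > 2" and "prime p"
    and "f \<in> modular_field N - (\<lambda>h. h ^ p) ` modular_field N"
    and "f \<in> modular_units N"
    and "eval_mero g holomorphic_on uhp" and "g ^ p = f"
    and "M > 0" and "N dvd M" and "has_level M g"
  shows "has_level (p * N) g"
proof -
  have p: "p > 0" using assms(2) by (simp add: prime_gt_0_nat)
  \<comment> \<open>The stabiliser of \<open>g\<close>; Wohlfahrt's theorem is applied to it with
    \<open>L = p * N\<close>.\<close>
  define H where "H = {A \<in> SL2Z. \<forall>z\<in>uhp. eval_mero g (moebius A z) = eval_mero g z}"
  have "has_level N f" using assms(3) by (simp add: modular_field_def)
  hence inv: "eval_mero f (moebius A z) = eval_mero f z"
    if "A \<in> principal_congruence N" "z \<in> uhp" for A z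
    using that by (auto simp: has_level_def)
  have SL: "principal_congruence K \<subseteq> SL2Z" for K by (auto simp: principal_congruence_def)
  have par: "parab \<alpha> \<gamma> (int (p * N) * j) \<in> H" for \<alpha> \<gamma> j
  proof -
    \<comment> \<open>\<open>P\<close> fixes \<open>f = g ^ p\<close>, so its \<open>p\<close>-th
      power, the required parabolic element, fixes \<open>g\<close>.\<close>
    define P where "P = parab \<alpha> \<gamma> (int N * j)"
    have P: "P \<in> principal_congruence N"
      unfolding P_def by (rule parab_in_principal_congruence)
    have Pp: "((**) P ^^ p) (mat 1) = parab \<alpha> \<gamma> (int (p * N) * j)"
      unfolding P_def parab_funpow by (simp add: mult_ac)
    have "eval_mero g (moebius (((**) P ^^ p) (mat 1)) z) = eval_mero g z" if "z \<in> uhp" for z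
    proof (rule root_invariant_under_power)
      show "eval_mero (g ^ p) (moebius P z) = eval_mero (g ^ p) z" if "z \<in> uhp" for z
        using inv[OF P that] assms(6) by simp
    qed (use assms p that P SL in auto)
    thus ?thesis
      using parab_in_principal_congruence[of \<alpha> \<gamma> "p * N" j] SL by (auto simp: H_def Pp)
  qed
  have cong: "principal_congruence M \<subseteq> H"
    using assms(9) SL by (auto simp: H_def has_level_def)
  have mult: "A ** B \<in> H" if "A \<in> H" "B \<in> H" for A B
    using that by (auto simp: H_def SL2Z_mult moebius_mult moebius_in_uhp)
  have invar: "eval_mero g (moebius A z) = eval_mero g z"
    if "A \<in> principal_congruence (p * N)" "z \<in> uhp" for A z
    using that(1)
  proof (rule principal_congruence_cases)
    fix a b c d
    assume *: "a * d - b * c = 1" "int (p * N) dvd a - 1" "int (p * N) dvd b" "int (p * N) dvd c"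
      and A: "A = mat2 a b c d \<or> A = - mat2 a b c d"
    have "mat2 a b c d \<in> H"
      by (rule principal_congruence_subset_generated[OF assms(7) mult cong par *])
    thus ?thesis using A that(2) by (auto simp: H_def moebius_uminus)
  qed
  have "\<exists>G. has_q_expansion (p * N) (\<lambda>z. eval_mero g (moebius B z)) G" if B: "B \<in> SL2Z" for B
  proof -
    obtain F where F: "has_q_expansion M (\<lambda>z. eval_mero g (moebius B z)) F"
      using assms(9) B by (auto simp: has_level_def)
    obtain a b c d where B_eq: "B = mat2 a b c d" using mat2_cases by blast
    show ?thesis
    proof (rule has_q_expansion_descend)
      \<comment> \<open>\<open>M\<close> need not be a multiple of \<open>p * N\<close>, so the
        expansion is first lifted to the common multiple \<open>M * (p * N)\<close> and then
        descends by the factor \<open>M\<close>.\<close>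
      show "has_q_expansion (M * (p * N)) (\<lambda>z. eval_mero g (moebius B z))
              (fls_compose_fps F (fps_X ^ (p * N)))"
        using has_q_expansion_lift[OF F assms(7), of "p * N"] p assms(1) by (simp add: mult_ac)
      show "eval_mero g (moebius B (z + of_nat (p * N))) = eval_mero g (moebius B z)"
        if "Im z > 0" for z
      proof -
        have z: "z \<in> uhp" using that by (simp add: uhp_def)
        \<comment> \<open>The period \<open>p * N\<close> at the cusp given by \<open>B\<close>
          comes from the parabolic element built from the first column of \<open>B\<close>.\<close>
        have "moebius B (z + of_int (int (p * N))) =
                moebius (parab a c (int (p * N))) (moebius B z)"
          using moebius_translation B z unfolding B_eq by blast
        moreover have "parab a c (int (p * N)) \<in> H" using par[of a c 1] by simp
        ultimately show ?thesis using moebius_in_uhp[OF z B] by (simp add: H_def)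
      qed
    qed (use assms p in auto)
  qed
  with invar show ?thesis by (auto simp: has_level_def)
qed

end
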